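(* Let $1\le\alpha\le2$, $\sigma\ge0$, and let $X_1,\dots,X_B$ be a $d$-dimensional martingale difference sequence (i.e. $\mathbb{E}[X_i\mid X_{i-1},\dots,X_1]=0$ for $1<i\le B$) satisfying $$\mathbb{E}\big[\|X_i\|_2^{\alpha}\,\big|\,X_{i-1},\dots,X_1\big]\le\sigma^{\alpha}$$ for all $1\le i\le B$. Then $$\mathbb{E}\left[\left\|\frac1B\sum_{i=1}^BX_i\right\|_2^{\alpha}\right]\le\frac{2\sigma^{\alpha}}{B^{\alpha-1}}.$$
   Context: $\|\cdot\|_2$ is the Euclidean norm on $\mathbb{R}^d$, and the $X_i$ are random vectors in $\mathbb{R}^d$ on a common probability space. For $i=1$ the conditional expectation is the unconditional one. *)

theory Defs
  imports "HOL-Probability.Probability"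
begin

text \<open>The sigma-algebra on \<open>space M\<close> generated by \<open>X j\<close> for \<open>1 \<le> j < i\<close>.
  For \<open>i = 1\<close> it is trivial, so conditioning on it is taking the plain expectation.\<close>

definition past_algebra :: "'a measure \<Rightarrow> (nat \<Rightarrow> 'a \<Rightarrow> 'b::topological_space) \<Rightarrow> nat \<Rightarrow> 'a measure"
  where "past_algebra M X i =
    sigma (space M) (\<Union>j\<in>{1..<i}. {X j -` A \<inter> space M | A. A \<in> sets borel})"

lemma space_past_algebra [simp]: "space (past_algebra M X i) = space M"
  unfolding past_algebra_def by (rule space_measure_of) auto

lemma subalgebra_past_algebra:
  assumes "\<And>j. 1 \<le> j \<Longrightarrow> j < i \<Longrightarrow> X j \<in> borel_measurable M"
  shows "subalgebra M (past_algebra M X i)"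
proof -
  have "(\<Union>j\<in>{1..<i}. {X j -` A \<inter> space M | A. A \<in> sets borel}) \<subseteq> sets M"
    using assms by (auto intro: measurable_sets)
  then have "sets (past_algebra M X i) \<subseteq> sets M"
    unfolding past_algebra_def by (intro sets.sigma_sets_subset sets_measure_of[THEN equalityD1, THEN order_trans]) auto
  then show ?thesis
    by (simp add: subalgebra_def)
qed

text \<open>The library only has conditional expectations of scalar functions; for an integrable
  random vector the conditional expectation is taken coordinatewise.\<close>

definition vec_cond_exp ::
    "'a measure \<Rightarrow> 'a measure \<Rightarrow> ('a \<Rightarrow> real ^ 'd) \<Rightarrow> 'a \<Rightarrow> real ^ 'd"
  where "vec_cond_exp M F f = (\<lambda>\<omega>. \<chi> k. real_cond_exp M F (\<lambda>\<omega>. f \<omega> $ k) \<omega>)"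

text \<open>The condition starts at \<open>i = 2\<close>: \<open>X 1\<close> need not be centred.\<close>

definition martingale_difference_seq ::
    "'a measure \<Rightarrow> nat \<Rightarrow> (nat \<Rightarrow> 'a \<Rightarrow> real ^ 'd) \<Rightarrow> bool"
  where "martingale_difference_seq M B X \<longleftrightarrow>
    (\<forall>i. 1 \<le> i \<and> i \<le> B \<longrightarrow> integrable M (X i)) \<and>
    (\<forall>i. 1 < i \<and> i \<le> B \<longrightarrow>
      (AE \<omega> in M. vec_cond_exp M (past_algebra M X i) (X i) \<omega> = 0))"

end

theory Submission imports Defs begin

text \<open>The key is the pointwise inequality
  \<open>\<parallel>x + y\<parallel>\<^sup>\<alpha> \<le> \<parallel>x\<parallel>\<^sup>\<alpha> + \<alpha> \<parallel>x\<parallel>\<^bsup>\<alpha>-2\<^esup> \<langle>x, y\<rangle> + 2 \<parallel>y\<parallel>\<^sup>\<alpha>\<close> for \<open>1 \<le> \<alpha> \<le> 2\<close>.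
  With \<open>x\<close> the partial sum of the first \<open>n\<close> differences and \<open>y\<close> the next difference, the middle
  term has mean zero, so each step raises the \<open>\<alpha>\<close>-th moment of the partial sums by at most
  \<open>2 \<sigma>\<^sup>\<alpha>\<close>.\<close>

section \<open>The pointwise inequality for powers of the norm\<close>

lemma powr_le_tangent:
  fixes q u v :: real
  assumes "0 \<le> q" "q \<le> 1" "0 \<le> u" "0 < v"
  shows "u powr q \<le> v powr q + q * v powr (q - 1) * (u - v)"
proof -
  \<comment> \<open>Weighted AM-GM with weights \<open>q\<close> and \<open>1 - q\<close>.
    Multiplying by \<open>v powr (q - 1)\<close> turns it into the tangent-line bound at
    \<open>v\<close>.\<close>
  have "u powr q * v powr (1 - q) \<le> q * u + (1 - q) * v"
    using Youngs_inequality_0[of q "1 - q" u v] assms by (cases "u = 0") auto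
  then have "u powr q * v powr (1 - q) * v powr (q - 1) \<le> (q * u + (1 - q) * v) * v powr (q - 1)"
    by (rule mult_right_mono) simp
  moreover have "v powr (1 - q) * v powr (q - 1) = 1"
    using assms by (simp flip: powr_add)
  moreover have "v * v powr (q - 1) = v powr q"
    using assms by (simp add: powr_mult_base)
  ultimately show ?thesis
    by (simp add: algebra_simps)
qed

text \<open>Since \<alpha>/2 \<le> 1, the \<alpha>-th power of the norm is a concave function of the
  squared norm, so it lies below its tangent at \<open>r\<^sup>2\<close>. The radius
  \<open>r\<close> stays free because the next proof needs two different choices of it.\<close>

lemma norm_add_powr_le_tangent:
  fixes x y :: "'a::real_inner" and \<alpha> r :: real
  assumes "0 \<le> \<alpha>" "\<alpha> \<le> 2" "0 < r"
  shows "norm (x + y) powr \<alpha>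
    \<le> r powr \<alpha> + \<alpha> / 2 * r powr (\<alpha> - 2) * ((norm x)\<^sup>2 + 2 * (x \<bullet> y) + (norm y)\<^sup>2 - r\<^sup>2)"
proof -
  have sq: "(z\<^sup>2) powr s = z powr (2 * s)" if "0 \<le> z" for z s :: real
    using that by (cases "z = 0") (simp_all add: powr_powr flip: powr_numeral)
  have "((norm (x + y))\<^sup>2) powr (\<alpha> / 2) \<le> (r\<^sup>2) powr (\<alpha> / 2)
      + \<alpha> / 2 * (r\<^sup>2) powr (\<alpha> / 2 - 1) * ((norm (x + y))\<^sup>2 - r\<^sup>2)"
    by (rule powr_le_tangent) (use assms in auto)
  moreover have "(norm (x + y))\<^sup>2 = (norm x)\<^sup>2 + 2 * (x \<bullet> y) + (norm y)\<^sup>2"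
    by (simp add: power2_norm_eq_inner inner_add_left inner_add_right inner_commute)
  moreover have "(r\<^sup>2) powr s = r powr (2 * s)" for s
    using assms by (simp add: sq)
  moreover have "((norm (x + y))\<^sup>2) powr (\<alpha> / 2) = norm (x + y) powr \<alpha>"
    by (simp add: sq)
  ultimately show ?thesis
    by (simp add: right_diff_distrib)
qed

text \<open>Write a and b for the norms of \<open>x\<close> and \<open>y\<close>. If b \<le> 2a, the
  tangent at radius a already contains the wanted cross term. If b > 2a, the tangent is taken at b -
  a, the least possible norm of \<open>x + y\<close>.\<close>

lemma norm_add_powr_le:
  fixes x y :: "'a::real_inner" and \<alpha> :: real
  assumes \<alpha>: "1 \<le> \<alpha>" "\<alpha> \<le> 2"
  shows "norm (x + y) powr \<alpha>
    \<le> norm x powr \<alpha> + \<alpha> * ((norm x powr (\<alpha> - 2) *\<^sub>R x) \<bullet> y) + 2 * norm y powr \<alpha>"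
proof -
  define a b c where "a = norm x" and "b = norm y" and "c = x \<bullet> y"
  have "\<bar>c\<bar> \<le> a * b"
    unfolding a_def b_def c_def by (rule Cauchy_Schwarz_ineq2)
  then have c: "0 \<le> c + a * b"
    by linarith
  have ab: "0 \<le> a" "0 \<le> b"
    by (auto simp: a_def b_def)
  have sq: "z\<^sup>2 * z powr (\<alpha> - 2) = z powr \<alpha>" if "0 < z" for z
    using that by (simp flip: powr_numeral powr_add)
  have "norm (x + y) powr \<alpha> \<le> a powr \<alpha> + \<alpha> * a powr (\<alpha> - 2) * c + 2 * b powr \<alpha>"
  \<comment> \<open>In the degenerate cases the cross term vanishes: for a = 0 by the convention
    \<open>0 powr s = 0\<close>, for b = 0 because \<open>y = 0\<close>.\<close>
  proof (cases "a = 0 \<or> b = 0")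
    case True
    then show ?thesis
      by (auto simp: a_def b_def c_def)
  next
    case False
    with ab have pos: "0 < a" "0 < b"
      by auto
    show ?thesis
    proof (cases "b \<le> 2 * a")
      case True
      have "norm (x + y) powr \<alpha>
          \<le> a powr \<alpha> + \<alpha> / 2 * a powr (\<alpha> - 2) * (a\<^sup>2 + 2 * c + b\<^sup>2 - a\<^sup>2)"
        unfolding a_def b_def c_def
        by (rule norm_add_powr_le_tangent) (use \<alpha> pos in \<open>auto simp: a_def\<close>)
      also have "\<dots> = a powr \<alpha> + \<alpha> * a powr (\<alpha> - 2) * c + \<alpha> / 2 * (b\<^sup>2 * a powr (\<alpha> - 2))"
        by (simp add: algebra_simps)
      also have "\<alpha> / 2 * (b\<^sup>2 * a powr (\<alpha> - 2)) \<le> 1 * (2 * b powr \<alpha>)"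
      proof (rule mult_mono)
        \<comment> \<open>The exponent \<alpha> - 2 is nonpositive, so a \<ge> b/2 bounds the power
          from above. The constant 2 arises as a bound for \<open>2 powr (2 - \<alpha>)\<close>,
          which uses \<alpha> \<ge> 1.\<close>
        have "a powr (\<alpha> - 2) \<le> (b / 2) powr (\<alpha> - 2)"
          by (rule powr_mono2') (use True pos \<alpha> in auto)
        also have "\<dots> = 2 powr (2 - \<alpha>) * b powr (\<alpha> - 2)"
          using pos by (simp add: powr_divide powr_diff field_simps)
        also have "\<dots> \<le> 2 * b powr (\<alpha> - 2)"
          using powr_mono[of "2 - \<alpha>" 1 "2::real"] \<alpha> by (intro mult_right_mono) auto
        finally have "b\<^sup>2 * a powr (\<alpha> - 2) \<le> b\<^sup>2 * (2 * b powr (\<alpha> - 2))"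
          by (rule mult_left_mono) simp
        then show "b\<^sup>2 * a powr (\<alpha> - 2) \<le> 2 * b powr \<alpha>"
          using sq[OF pos(2)] by simp
      qed (use \<alpha> in auto)
      finally show ?thesis by simp
    next
      case False
      define t where "t = a / b"
      have t: "0 < t" "t \<le> 1/2" "a = t * b"
        using pos False by (auto simp: t_def field_simps)
      have d: "0 < b - a" "a \<le> b - a"
        using pos False by auto
      have "norm (x + y) powr \<alpha> \<le> (b - a) powr \<alpha>
          + \<alpha> / 2 * (b - a) powr (\<alpha> - 2) * (a\<^sup>2 + 2 * c + b\<^sup>2 - (b - a)\<^sup>2)"
        unfolding a_def b_def c_def
        by (rule norm_add_powr_le_tangent) (use \<alpha> d in \<open>auto simp: a_def b_def\<close>)
      also have "\<dots> = (b - a) powr \<alpha> + \<alpha> * (b - a) powr (\<alpha> - 2) * (c + a * b)"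
        by (simp add: algebra_simps power2_eq_square)
      \<comment> \<open>Since a \<le> b - a and c + ab \<ge> 0 by Cauchy-Schwarz, the nonpositive
        exponent allows b - a to be replaced by a. This gives the cross term its required
        coefficient.\<close>
      also have "\<dots> \<le> (b - a) powr \<alpha> + \<alpha> * a powr (\<alpha> - 2) * (c + a * b)"
        using \<alpha> pos d c
        by (intro add_left_mono mult_right_mono mult_left_mono powr_mono2') auto
      also have "\<dots> = \<alpha> * a powr (\<alpha> - 2) * c + ((b - a) powr \<alpha> + \<alpha> * a powr (\<alpha> - 1) * b)"
        using pos powr_mult_base[of a "\<alpha> - 2"] by (simp add: algebra_simps)
      also have "(b - a) powr \<alpha> + \<alpha> * a powr (\<alpha> - 1) * b
          = ((1 - t) powr \<alpha> + \<alpha> * t powr (\<alpha> - 1)) * b powr \<alpha>"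
      proof -
        have "b - a = (1 - t) * b"
          using t by (simp add: algebra_simps)
        then have "(b - a) powr \<alpha> = (1 - t) powr \<alpha> * b powr \<alpha>"
          using t pos by (simp add: powr_mult)
        moreover have "a powr (\<alpha> - 1) * b = t powr (\<alpha> - 1) * b powr \<alpha>"
          using t pos powr_mult_base[of b "\<alpha> - 1"] by (simp add: powr_mult algebra_simps)
        ultimately show ?thesis
          by (simp add: algebra_simps)
      qed
      also have "\<dots> \<le> 2 * b powr \<alpha>"
      proof (rule mult_right_mono)
        \<comment> \<open>By homogeneity only the ratio t matters. Both powers are bounded by affine
          functions of t, the second by its tangent at 1.\<close>
        have "(1 - t) powr \<alpha> \<le> (1 - t) powr 1"
          by (rule powr_mono') (use t \<alpha> in auto)
        moreover have "t powr (\<alpha> - 1) \<le> 1 + (\<alpha> - 1) * (t - 1)"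
          using powr_le_tangent[of "\<alpha> - 1" t 1] t \<alpha> by simp
        then have "\<alpha> * t powr (\<alpha> - 1) \<le> \<alpha> * (1 + (\<alpha> - 1) * (t - 1))"
          by (rule mult_left_mono) (use \<alpha> in auto)
        moreover have "(1 - t) + \<alpha> * (1 + (\<alpha> - 1) * (t - 1)) \<le> 2"
        proof -
          \<comment> \<open>The sum of these two terms is exactly 2 minus the left-hand
            side.\<close>
          have "0 \<le> (\<alpha> - 1)\<^sup>2 * (1 - t)" "0 \<le> t * (2 - \<alpha>)"
            using t \<alpha> by auto
          then show ?thesis
            by (simp add: algebra_simps power2_eq_square)
        qed
        ultimately show "(1 - t) powr \<alpha> + \<alpha> * t powr (\<alpha> - 1) \<le> 2"
          using t by simp
      qed simp
      finally show ?thesis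
        using powr_ge_zero[of a \<alpha>] by linarith
    qed
  qed
  then show ?thesis
    by (simp add: a_def b_def c_def)
qed

section \<open>Conditioning on the past, and integrability of the cross term\<close>

lemma measurable_past_algebra:
  assumes "1 \<le> j" "j < i"
  shows "X j \<in> borel_measurable (past_algebra M X i)"
proof (rule measurableI)
  fix A :: "'b set" assume "A \<in> sets borel"
  then have "X j -` A \<inter> space M \<in> (\<Union>j\<in>{1..<i}. {X j -` A \<inter> space M | A. A \<in> sets borel})"
    using assms by (intro UN_I[of j]) auto
  then show "X j -` A \<inter> space (past_algebra M X i) \<in> sets (past_algebra M X i)"
    unfolding space_past_algebra unfolding past_algebra_def
    by (intro in_measure_of) auto
qed simp

text \<open>In each coordinate the \<open>F\<close>-measurable factor is pulled out of the
  conditional expectation, which is zero. \<open>G\<close> need not be bounded: the integrable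
  product of norms dominates every coordinate product.\<close>

lemma (in sigma_finite_subalgebra) integral_inner_cond_exp_zero:
  fixes G Y :: "'a \<Rightarrow> real ^ 'd"
  assumes G: "G \<in> borel_measurable F" and Y: "Y \<in> borel_measurable M"
    and int: "integrable M (\<lambda>\<omega>. norm (G \<omega>) * norm (Y \<omega>))"
    and zero: "AE \<omega> in M. vec_cond_exp M F Y \<omega> = 0"
  shows "integrable M (\<lambda>\<omega>. G \<omega> \<bullet> Y \<omega>)" and "(\<integral>\<omega>. G \<omega> \<bullet> Y \<omega> \<partial>M) = 0"
proof -
  have Gk: "(\<lambda>\<omega>. G \<omega> $ k) \<in> borel_measurable F" for k
    using borel_measurable_inner[OF G borel_measurable_const[of "axis k 1"]]
    by (simp add: inner_axis)
  have Yk: "(\<lambda>\<omega>. Y \<omega> $ k) \<in> borel_measurable M" for k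
    using borel_measurable_inner[OF Y borel_measurable_const[of "axis k 1"]]
    by (simp add: inner_axis)
  have ik: "integrable M (\<lambda>\<omega>. G \<omega> $ k * Y \<omega> $ k)" for k
  proof (rule Bochner_Integration.integrable_bound[OF int])
    show "(\<lambda>\<omega>. G \<omega> $ k * Y \<omega> $ k) \<in> borel_measurable M"
      using measurable_from_subalg[OF subalg Gk] Yk by (rule borel_measurable_times)
    show "AE \<omega> in M. norm (G \<omega> $ k * Y \<omega> $ k) \<le> norm (norm (G \<omega>) * norm (Y \<omega>))"
      by (auto simp: abs_mult intro!: mult_mono component_le_norm_cart)
  qed
  have zk: "(\<integral>\<omega>. G \<omega> $ k * Y \<omega> $ k \<partial>M) = 0" for k
  proof -
    have "AE \<omega> in M. G \<omega> $ k * real_cond_exp M F (\<lambda>\<omega>. Y \<omega> $ k) \<omega> = 0"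
      using zero by eventually_elim (simp add: vec_cond_exp_def vec_eq_iff)
    then have "(\<integral>\<omega>. G \<omega> $ k * real_cond_exp M F (\<lambda>\<omega>. Y \<omega> $ k) \<omega> \<partial>M) = 0"
      by (rule integral_eq_zero_AE)
    then show ?thesis
      using real_cond_exp_intg(2)[OF ik Gk Yk] by simp
  qed
  show "integrable M (\<lambda>\<omega>. G \<omega> \<bullet> Y \<omega>)"
    unfolding inner_vec_def by (auto intro: ik)
  show "(\<integral>\<omega>. G \<omega> \<bullet> Y \<omega> \<partial>M) = 0"
    unfolding inner_vec_def by (simp add: ik zk)
qed

text \<open>The tower property, with total mass one. Working in \<open>ennreal\<close> requires no
  prior integrability, so a finite \<open>C\<close> yields finiteness of the moment.\<close>

lemma (in prob_space) nn_integral_le_of_nn_cond_exp_le: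
  assumes "subalgebra M F" "f \<in> borel_measurable M"
    and "AE \<omega> in M. nn_cond_exp M F f \<omega> \<le> C"
  shows "(\<integral>\<^sup>+ \<omega>. f \<omega> \<partial>M) \<le> C"
proof -
  interpret finite_measure_subalgebra M F
    by unfold_locales (rule assms)
  have "(\<integral>\<^sup>+ \<omega>. f \<omega> \<partial>M) = (\<integral>\<^sup>+ \<omega>. nn_cond_exp M F f \<omega> \<partial>M)"
    using nn_cond_exp_intg[of "\<lambda>_. 1" f] assms by simp
  also have "\<dots> \<le> (\<integral>\<^sup>+ \<omega>. C \<partial>M)"
    by (rule nn_integral_mono_AE) (rule assms)
  finally show ?thesis
    by (simp add: emeasure_space_1)
qed

text \<open>Replacing both factors by the larger of \<open>a\<close> and \<open>b\<close> gives one
  of the two summands. This dominates the cross term by \<alpha>-th moments.\<close>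

lemma powr_mult_le_sum_powr:
  fixes a b \<alpha> :: real
  assumes "0 \<le> a" "0 \<le> b" "1 \<le> \<alpha>"
  shows "a powr (\<alpha> - 1) * b \<le> a powr \<alpha> + b powr \<alpha>"
proof -
  define m where "m = max a b"
  have "a powr (\<alpha> - 1) * b \<le> m powr (\<alpha> - 1) * m"
    using assms by (intro mult_mono powr_mono2) (auto simp: m_def)
  also have "\<dots> = m powr \<alpha>"
    using assms powr_mult_base[of m "\<alpha> - 1"] by (simp add: m_def mult.commute)
  also have "\<dots> \<le> a powr \<alpha> + b powr \<alpha>"
    by (simp add: m_def max_def)
  finally show ?thesis .
qed

section \<open>Moments of the partial sums\<close>

theorem lemma4:
  fixes M :: "'a measure"
    and X :: "nat \<Rightarrow> 'a \<Rightarrow> real ^ 'd"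
    and B :: nat
    and \<alpha> \<sigma> :: real
  assumes "prob_space M"
    and "1 \<le> \<alpha>" and "\<alpha> \<le> 2" and "0 \<le> \<sigma>" and "1 \<le> B"
    and "\<And>i. 1 \<le> i \<Longrightarrow> i \<le> B \<Longrightarrow> X i \<in> borel_measurable M"
    and "martingale_difference_seq M B X"
    and "\<And>i. 1 \<le> i \<Longrightarrow> i \<le> B \<Longrightarrow>
      AE \<omega> in M. nn_cond_exp M (past_algebra M X i) (\<lambda>\<omega>. ennreal (norm (X i \<omega>) powr \<alpha>)) \<omega>
        \<le> ennreal (\<sigma> powr \<alpha>)"
  shows "(\<integral>\<^sup>+ \<omega>. ennreal (norm ((1 / real B) *\<^sub>R (\<Sum>i = 1..B. X i \<omega>)) powr \<alpha>) \<partial>M)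
    \<le> ennreal (2 * \<sigma> powr \<alpha> / real B powr (\<alpha> - 1))"
proof -
  interpret prob_space M by fact
  note \<alpha> = \<open>1 \<le> \<alpha>\<close> \<open>\<alpha> \<le> 2\<close>
  note meas = assms(6)
  define S where "S n \<omega> = (\<Sum>i = 1..n. X i \<omega>)" for n \<omega>
  have subalg: "subalgebra M (past_algebra M X i)" if "i \<le> B" for i
    by (rule subalgebra_past_algebra) (use that meas in auto)
  have X_le: "(\<integral>\<^sup>+ \<omega>. ennreal (norm (X i \<omega>) powr \<alpha>) \<partial>M) \<le> ennreal (\<sigma> powr \<alpha>)"
    if i: "1 \<le> i" "i \<le> B" for i
    using meas[OF i] by (intro nn_integral_le_of_nn_cond_exp_le[OF subalg _ assms(8)] i) auto
  have X_int: "integrable M (\<lambda>\<omega>. norm (X i \<omega>) powr \<alpha>)" if i: "1 \<le> i" "i \<le> B" for i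
  proof (rule integrableI_bounded)
    show "(\<lambda>\<omega>. norm (X i \<omega>) powr \<alpha>) \<in> borel_measurable M"
      using meas[OF i] by measurable
    show "(\<integral>\<^sup>+ \<omega>. ennreal (norm (norm (X i \<omega>) powr \<alpha>)) \<partial>M) < \<infinity>"
      using X_le[OF i] by (simp add: le_less_trans[OF _ ennreal_less_top])
  qed
  have X_le': "(\<integral> \<omega>. norm (X i \<omega>) powr \<alpha> \<partial>M) \<le> \<sigma> powr \<alpha>" if i: "1 \<le> i" "i \<le> B" for i
    using X_le[OF i] by (simp add: nn_integral_eq_integral[OF X_int[OF i]])
  \<comment> \<open>Integrability is part of the induction claim: the next cross term relies on it,
    and a Bochner integral of a non-integrable function is 0, so the bound alone would say
    nothing.\<close>
  have S_le: "integrable M (\<lambda>\<omega>. norm (S n \<omega>) powr \<alpha>) \<and>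
      (\<integral> \<omega>. norm (S n \<omega>) powr \<alpha> \<partial>M) \<le> real n * (2 * \<sigma> powr \<alpha>)" if "n \<le> B" for n
    using that
  proof (induction n)
    case 0
    then show ?case
      by (simp add: S_def)
  next
    case (Suc n)
    define i where "i = Suc n"
    have i: "1 \<le> i" "i \<le> B"
      using Suc.prems by (auto simp: i_def)
    from Suc have IH: "integrable M (\<lambda>\<omega>. norm (S n \<omega>) powr \<alpha>)"
        "(\<integral> \<omega>. norm (S n \<omega>) powr \<alpha> \<partial>M) \<le> real n * (2 * \<sigma> powr \<alpha>)"
      by auto
    \<comment> \<open>Up to the factor \<alpha>, this is the gradient of the \<alpha>-th power of
      the norm at \<open>S n \<omega>\<close>. At the origin it is 0, and \<open>normG\<close> holds
      there too, even for \<alpha> = 1, because \<open>0 powr 0 = 0\<close>.\<close>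
    define G where "G \<omega> = norm (S n \<omega>) powr (\<alpha> - 2) *\<^sub>R S n \<omega>" for \<omega>
    have normG: "norm (G \<omega>) = norm (S n \<omega>) powr (\<alpha> - 1)" for \<omega>
      using powr_mult_base[of "norm (S n \<omega>)" "\<alpha> - 2"] by (simp add: G_def mult.commute)
    \<comment> \<open>\<open>S n\<close> involves only indices up to n = i - 1, exactly those
      generating the past at \<open>i\<close>.\<close>
    have S_meas: "S n \<in> borel_measurable (past_algebra M X i)"
      unfolding S_def[abs_def]
      by (intro borel_measurable_sum measurable_past_algebra) (auto simp: i_def)
    then have G_meas: "G \<in> borel_measurable (past_algebra M X i)"
      unfolding G_def[abs_def] by measurable
    have S_meas': "S n \<in> borel_measurable M"
      by (rule measurable_from_subalg[OF subalg[OF i(2)] S_meas])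
    have G_meas': "G \<in> borel_measurable M"
      by (rule measurable_from_subalg[OF subalg[OF i(2)] G_meas])
    have prod_int: "integrable M (\<lambda>\<omega>. norm (G \<omega>) * norm (X i \<omega>))"
    proof (rule Bochner_Integration.integrable_bound)
      show "integrable M (\<lambda>\<omega>. norm (S n \<omega>) powr \<alpha> + norm (X i \<omega>) powr \<alpha>)"
        using IH(1) X_int[OF i] by (rule Bochner_Integration.integrable_add)
      show "(\<lambda>\<omega>. norm (G \<omega>) * norm (X i \<omega>)) \<in> borel_measurable M"
        using G_meas' meas[OF i] by measurable
      show "AE \<omega> in M. norm (norm (G \<omega>) * norm (X i \<omega>))
          \<le> norm (norm (S n \<omega>) powr \<alpha> + norm (X i \<omega>) powr \<alpha>)"
        using \<alpha> by (auto simp: normG intro!: powr_mult_le_sum_powr)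
    qed
    \<comment> \<open>\<open>X 1\<close> need not be centred, but in the first step \<open>G\<close> vanishes.\<close>
    have cross: "integrable M (\<lambda>\<omega>. G \<omega> \<bullet> X i \<omega>) \<and> (\<integral> \<omega>. G \<omega> \<bullet> X i \<omega> \<partial>M) = 0"
    proof (cases "n = 0")
      case True
      then show ?thesis
        by (simp add: G_def S_def)
    next
      case False
      interpret finite_measure_subalgebra M "past_algebra M X i"
        by unfold_locales (rule subalg[OF i(2)])
      have "AE \<omega> in M. vec_cond_exp M (past_algebra M X i) (X i) \<omega> = 0"
        using assms(7) False i by (auto simp: martingale_difference_seq_def i_def)
      then show ?thesis
        using integral_inner_cond_exp_zero[OF G_meas meas[OF i] prod_int] by simp
    qed
    let ?R = "\<lambda>\<omega>. norm (S n \<omega>) powr \<alpha> + \<alpha> * (G \<omega> \<bullet> X i \<omega>) + 2 * norm (X i \<omega>) powr \<alpha>"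
    have R_int: "integrable M ?R"
      using IH(1) X_int[OF i] cross by auto
    have step: "norm (S (Suc n) \<omega>) powr \<alpha> \<le> ?R \<omega>" for \<omega>
      using norm_add_powr_le[OF \<alpha>, of "S n \<omega>" "X i \<omega>"] by (simp add: S_def G_def i_def)
    have "S (Suc n) \<in> borel_measurable M"
      unfolding S_def[abs_def] using Suc.prems by (intro borel_measurable_sum meas) auto
    then have int: "integrable M (\<lambda>\<omega>. norm (S (Suc n) \<omega>) powr \<alpha>)"
      by (intro Bochner_Integration.integrable_bound[OF R_int])
        (auto intro: order_trans[OF step abs_ge_self])
    have "(\<integral> \<omega>. norm (S (Suc n) \<omega>) powr \<alpha> \<partial>M) \<le> (\<integral> \<omega>. ?R \<omega> \<partial>M)"
      by (intro integral_mono int R_int step)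
    also have "\<dots> = (\<integral> \<omega>. norm (S n \<omega>) powr \<alpha> \<partial>M) + 2 * (\<integral> \<omega>. norm (X i \<omega>) powr \<alpha> \<partial>M)"
      using IH(1) X_int[OF i] cross by simp
    also have "\<dots> \<le> real (Suc n) * (2 * \<sigma> powr \<alpha>)"
      using IH(2) X_le'[OF i] by (simp add: algebra_simps)
    finally show ?case
      using int by simp
  qed
  have B: "0 < real B"
    using \<open>1 \<le> B\<close> by simp
  have "(\<integral>\<^sup>+ \<omega>. ennreal (norm ((1 / real B) *\<^sub>R (\<Sum>i = 1..B. X i \<omega>)) powr \<alpha>) \<partial>M)
      = (\<integral>\<^sup>+ \<omega>. ennreal ((1 / real B) powr \<alpha> * norm (S B \<omega>) powr \<alpha>) \<partial>M)"
    using B by (simp add: S_def powr_mult powr_divide)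
  also have "\<dots> = ennreal (\<integral> \<omega>. (1 / real B) powr \<alpha> * norm (S B \<omega>) powr \<alpha> \<partial>M)"
    using S_le[of B] by (intro nn_integral_eq_integral) auto
  \<comment> \<open>Averaging contributes \<open>B powr (-\<alpha>)\<close> and the B induction
    steps contribute a factor B, leaving \<open>B powr (1 - \<alpha>)\<close>.\<close>
  also have "\<dots> \<le> ennreal ((1 / real B) powr \<alpha> * (real B * (2 * \<sigma> powr \<alpha>)))"
    using S_le[of B] by (intro ennreal_leI) (simp add: mult_left_mono)
  also have "(1 / real B) powr \<alpha> * (real B * (2 * \<sigma> powr \<alpha>))
      = 2 * \<sigma> powr \<alpha> / real B powr (\<alpha> - 1)"
    using B by (simp add: powr_divide powr_diff field_simps)
  finally show ?thesis .
qed

end
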